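(* Let $\mathcal{A}$ be a Rickart *-ring and let $a,b\in\mathcal{A}$ be dual core invertible. Then $a\leq_{\oplus} b$ (dual core partial order) if and only if $a\preceq^{r*|\ell\square} b$, that is, if and only if $a\,\mathrm{rp}(b)=a=b\,\mathrm{rp}(a)$ and $a^2=ab$.
   Context: A *-ring is an (associative) ring $\mathcal{A}$ with an involution $*$: $(a+b)^*=a^*+b^*$, $(ab)^*=b^*a^*$, $(a^* )^*=a$. It is a Rickart *-ring if for every $a\in\mathcal{A}$ there is a self-adjoint idempotent $p$ (i.e. $p=p^*=p^2$) with $\{x\in\mathcal{A}: xa=0\}=\mathcal{A}(1-p)$; such a ring has an identity $1$. In a Rickart *-ring, for every $a$ there is also a unique self-adjoint idempotent $\mathrm{rp}(a)$ with $\{x\in\mathcal{A}: ax=0\}=(1-\mathrm{rp}(a))\mathcal{A}$. An element $a\in\mathcal{A}$ is dual core invertible if there is $a_{\oplus}\in\mathcal{A}$ with $aa_{\oplus}a=a$, $a_{\oplus}\mathcal{A}=a^*\mathcal{A}$ and $\mathcal{A}a_{\oplus}=\mathcal{A}a$; such $a_{\oplus}$ is unique and called the dual core inverse of $a$. For dual core invertible $a,b$, the dual core partial order is defined by: $a\leq_{\oplus}b$ iff $a_{\oplus}a=a_{\oplus}b$ and $aa_{\oplus}=ba_{\oplus}$. *)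

theory Defs
  imports Main
begin

text \<open>The sort is \<open>ring + monoid_mult\<close> rather than \<open>ring_1\<close>, because the latter excludes the
  trivial ring by requiring \<open>0 \<noteq> 1\<close>. The identity is part of the structure since it is
  needed to form \<open>1 - p\<close> in the definition of a Rickart *-ring.\<close>

class star_ring = ring + monoid_mult +
  fixes star :: "'a \<Rightarrow> 'a"
  assumes star_add: "star (a + b) = star a + star b"
    and star_mult: "star (a * b) = star b * star a"
    and star_star [simp]: "star (star a) = a"
begin

definition projection :: "'a \<Rightarrow> bool"
  where "projection p \<longleftrightarrow> p = star p \<and> p = p * p"

definition is_rp :: "'a \<Rightarrow> 'a \<Rightarrow> bool"
  where "is_rp a p \<longleftrightarrow> projection p \<and> {x. a * x = 0} = range (\<lambda>y. (1 - p) * y)"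

definition rp :: "'a \<Rightarrow> 'a"
  where "rp a = (THE p. is_rp a p)"

definition is_dual_core_inverse :: "'a \<Rightarrow> 'a \<Rightarrow> bool"
  where "is_dual_core_inverse a x \<longleftrightarrow>
    a * x * a = a \<and>
    range (\<lambda>y. x * y) = range (\<lambda>y. star a * y) \<and>
    range (\<lambda>y. y * x) = range (\<lambda>y. y * a)"

definition dual_core_invertible :: "'a \<Rightarrow> bool"
  where "dual_core_invertible a \<longleftrightarrow> (\<exists>x. is_dual_core_inverse a x)"

definition dual_core_inverse :: "'a \<Rightarrow> 'a"
  where "dual_core_inverse a = (THE x. is_dual_core_inverse a x)"

text \<open>Only meaningful for dual core invertible arguments.\<close>

definition dual_core_le :: "'a \<Rightarrow> 'a \<Rightarrow> bool"
  where "dual_core_le a b \<longleftrightarrow>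
    dual_core_inverse a * a = dual_core_inverse a * b \<and>
    a * dual_core_inverse a = b * dual_core_inverse a"

text \<open>The relation \<open>a \<preceq>\<close> \<open>b\<close> with superscript \<open>r*|l\<box>\<close>.\<close>

definition rstar_lsquare_le :: "'a \<Rightarrow> 'a \<Rightarrow> bool"
  where "rstar_lsquare_le a b \<longleftrightarrow> a * rp b = a \<and> a = b * rp a \<and> a ^ 2 = a * b"

end

class rickart_star_ring = star_ring +
  assumes rickart: "\<exists>p. projection p \<and> {x. x * a = 0} = range (\<lambda>y. y * (1 - p))"

text \<open>The definite descriptions above are well defined.\<close>

context star_ring
begin

lemma star_zero [simp]: "star 0 = 0"
  using star_add [of 0 0] by simp

lemma star_one [simp]: "star 1 = 1"
  by (metis star_mult star_star mult_1_left mult_1_right)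

lemma star_minus: "star (a - b) = star a - star b"
  by (metis star_add diff_add_cancel add_diff_cancel_right')

lemma is_rp_unique:
  assumes "is_rp a p" and "is_rp a q"
  shows "p = q"
proof -
  have *: "q * r = q" if "is_rp a q" "is_rp a r" for q r
  proof -
    have "1 - r \<in> range (\<lambda>y. (1 - r) * y)"
      by (rule range_eqI [of _ _ 1]) simp
    then have "1 - r \<in> range (\<lambda>y. (1 - q) * y)"
      using that unfolding is_rp_def by argo
    then obtain y where "1 - r = (1 - q) * y" ..
    moreover have "q * (1 - q) = 0"
      using that(1) unfolding is_rp_def projection_def by (simp add: right_diff_distrib)
    ultimately have "q * (1 - r) = 0"
      by (metis mult_assoc mult_zero_left)
    then show ?thesis by (simp add: right_diff_distrib)
  qed
  have "p * q = p" "q * p = q" using * assms by blast+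
  moreover have "star p = p" "star q = q"
    using assms unfolding is_rp_def projection_def by auto
  ultimately show ?thesis by (metis star_mult)
qed

lemma dual_core_inverse_unique:
  assumes "is_dual_core_inverse a x" and "is_dual_core_inverse a y"
  shows "x = y"
proof -
  have sa: "star (z * a) = z * a \<and> z * a * z = z" if "is_dual_core_inverse a z" for z
  proof -
    have aza: "a * z * a = a"
      using that by (simp add: is_dual_core_inverse_def)
    have "z \<in> range (\<lambda>y. star a * y)"
      using that unfolding is_dual_core_inverse_def by (metis mult_1_right rangeI)
    then obtain w where w: "z = star a * w" by auto
    have "star (z * a) * z = star (z * a) * star a * w"
      using w by (metis mult_assoc)
    also have "\<dots> = star (a * (z * a)) * w" by (simp add: star_mult)
    also have "\<dots> = z" using aza w by (simp add: mult_assoc)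
    finally have *: "star (z * a) * z = z" .
    then have "z * a = star (z * a) * (z * a)" by (metis mult_assoc)
    then have "star (z * a) = z * a" by (metis star_mult star_star)
    with * show ?thesis by simp
  qed
  have le: "u * a * (v * a) = v * a"
    if u: "is_dual_core_inverse a u" and v: "is_dual_core_inverse a v" for u v
  proof -
    have "v \<in> range (\<lambda>y. u * y)"
      using u v unfolding is_dual_core_inverse_def by (metis mult_1_right rangeI)
    then obtain w where "v = u * w" by auto
    then have "u * a * v = v" using sa [OF u] by (metis mult_assoc)
    then show ?thesis by (metis mult_assoc)
  qed
  have eq: "x * a = y * a"
    using le [OF assms] le [OF assms(2,1)] sa [OF assms(1)] sa [OF assms(2)]
    by (metis star_mult)
  have "y \<in> range (\<lambda>t. t * x)"
    using assms unfolding is_dual_core_inverse_def by (metis mult_1_left rangeI)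
  then obtain v where v: "y = v * x" by auto
  have "x = y * a * x" using sa [OF assms(1)] eq by simp
  also have "\<dots> = v * (x * a * x)" using v by (simp add: mult_assoc)
  also have "\<dots> = y" using sa [OF assms(1)] v by simp
  finally show ?thesis .
qed

lemma is_dual_core_inverse_dual_core_inverse:
  "dual_core_invertible a \<Longrightarrow> is_dual_core_inverse a (dual_core_inverse a)"
  unfolding dual_core_invertible_def dual_core_inverse_def
  by (metis dual_core_inverse_unique theI)

end

context rickart_star_ring
begin

lemma is_rp_rp: "is_rp a (rp a)"
proof -
  obtain p where p: "projection p" "{x. x * star a = 0} = range (\<lambda>y. y * (1 - p))"
    using rickart by blast
  have sp: "star (1 - p) = 1 - p"
    using p(1) unfolding projection_def by (simp add: star_minus)
  have "a * x = 0 \<longleftrightarrow> x \<in> range (\<lambda>y. (1 - p) * y)" for x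
  proof -
    have "a * x = 0 \<longleftrightarrow> star x * star a = 0" by (metis star_mult star_star star_zero)
    also have "\<dots> \<longleftrightarrow> (\<exists>y. star x = y * (1 - p))" using p(2) by auto
    also have "\<dots> \<longleftrightarrow> (\<exists>y. x = (1 - p) * y)" by (metis sp star_mult star_star)
    finally show ?thesis by auto
  qed
  then have "is_rp a p" using p(1) by (auto simp: is_rp_def)
  then show ?thesis unfolding rp_def by (metis is_rp_unique theI)
qed

end

end

theory Submission
  imports Defs
begin

text \<open>Let \<open>x\<close> be the dual core inverse of \<open>a\<close>. Since
  \<open>x * a\<close> is a projection with the same right annihilator as \<open>a\<close>, it
  equals \<open>rp a\<close> (\<open>is_rp_dual_core_inverse_mult\<close>). Hence
  \<open>a = b * rp a\<close> reads \<open>a = b * x * a\<close>, which is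
  \<open>a * x = b * x\<close> after cancelling with \<open>a * x * a = a\<close> and
  \<open>x * a * x = x\<close>. As \<open>a\<close> and \<open>x\<close> are left multiples of each
  other, left multiplication by either identifies the same pairs, so \<open>x * a = x * b\<close>
  amounts to \<open>a * a = a * b\<close>.\<close>

context star_ring
begin

text \<open>Writing \<open>x = star a * w\<close>, the adjoint of \<open>a * x * a = a\<close> gives
  \<open>star (x * a) * x = x\<close>. So \<open>x * a\<close> has the form
  \<open>star c * c\<close> with \<open>c = x * a\<close>, which is self-adjoint.\<close>

lemma is_dual_core_inverse_star_mult:
  assumes "is_dual_core_inverse a x"
  shows "star (x * a) = x * a" and "x * a * x = x"
proof -
  have axa: "a * x * a = a"
    using assms by (simp add: is_dual_core_inverse_def)
  have "x \<in> range (\<lambda>y. star a * y)"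
    using assms unfolding is_dual_core_inverse_def by (metis mult_1_right rangeI)
  then obtain w where w: "x = star a * w" by auto
  have "star (x * a) * x = star (x * a) * star a * w"
    using w by (metis mult_assoc)
  also have "\<dots> = star (a * (x * a)) * w" by (simp add: star_mult)
  also have "\<dots> = x" using axa w by (simp add: mult_assoc)
  finally have *: "star (x * a) * x = x" .
  then have "x * a = star (x * a) * (x * a)" by (metis mult_assoc)
  then show sa: "star (x * a) = x * a" by (metis star_mult star_star)
  show "x * a * x = x" using * sa by simp
qed

text \<open>The two factors carry equations \<open>x * c = x * d\<close> over to
  \<open>a * c = a * d\<close> and back.\<close>

lemma is_dual_core_inverse_left_ideal:
  assumes "is_dual_core_inverse a x"
  obtains v w where "x = v * a" and "a = w * x"
proof -
  have eq: "range (\<lambda>y. y * x) = range (\<lambda>y. y * a)"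
    using assms by (simp add: is_dual_core_inverse_def)
  have "x \<in> range (\<lambda>y. y * a)" "a \<in> range (\<lambda>y. y * x)"
    using eq by (metis mult_1_left rangeI)+
  then show ?thesis using that by blast
qed

text \<open>If \<open>a * z = 0\<close> then \<open>z = (1 - x * a) * z\<close>; conversely
  \<open>a * (1 - x * a) = 0\<close>.\<close>

lemma is_rp_dual_core_inverse_mult:
  assumes "is_dual_core_inverse a x"
  shows "is_rp a (x * a)"
proof -
  have axa: "a * (x * a) = a"
    using assms by (simp add: is_dual_core_inverse_def mult_assoc)
  have "projection (x * a)"
    using is_dual_core_inverse_star_mult [OF assms] axa
    unfolding projection_def by (simp add: mult_assoc)
  moreover have "a * z = 0 \<longleftrightarrow> z \<in> range (\<lambda>y. (1 - x * a) * y)" for z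
  proof
    assume "a * z = 0"
    then have "z = (1 - x * a) * z" by (simp add: left_diff_distrib mult_assoc)
    then show "z \<in> range (\<lambda>y. (1 - x * a) * y)" by (rule range_eqI)
  next
    assume "z \<in> range (\<lambda>y. (1 - x * a) * y)"
    then obtain y where "z = (1 - x * a) * y" ..
    moreover have "a * (1 - x * a) = 0" using axa by (simp add: right_diff_distrib)
    ultimately show "a * z = 0" by (metis mult_assoc mult_zero_left)
  qed
  ultimately show ?thesis by (auto simp: is_rp_def)
qed

lemma mult_is_rp:
  assumes "is_rp b p"
  shows "b * p = b"
proof -
  have "1 - p \<in> range (\<lambda>y. (1 - p) * y)"
    by (rule range_eqI [of _ _ 1]) simp
  then have "b * (1 - p) = 0"
    using assms unfolding is_rp_def by blast
  then show ?thesis by (simp add: right_diff_distrib)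
qed

end

theorem mainTheorem19:
  fixes a b :: "'a::rickart_star_ring"
  assumes "dual_core_invertible a" and "dual_core_invertible b"
  shows "dual_core_le a b \<longleftrightarrow> rstar_lsquare_le a b"
proof -
  define x where "x = dual_core_inverse a"
  have x: "is_dual_core_inverse a x"
    unfolding x_def by (rule is_dual_core_inverse_dual_core_inverse [OF assms(1)])
  have axa: "a * x * a = a"
    using x by (simp add: is_dual_core_inverse_def)
  have xax: "x * a * x = x"
    by (rule is_dual_core_inverse_star_mult(2) [OF x])
  have rpa: "rp a = x * a"
    by (rule is_rp_unique [OF is_rp_rp is_rp_dual_core_inverse_mult [OF x]])
  obtain v w where v: "x = v * a" and w: "a = w * x"
    by (rule is_dual_core_inverse_left_ideal [OF x])
  have "x * a = x * b \<and> a * x = b * x \<longleftrightarrow> a * rp b = a \<and> a = b * rp a \<and> a * a = a * b"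
  proof (intro iffI conjI; elim conjE)
    assume xa: "x * a = x * b" and ax: "a * x = b * x"
    \<comment> \<open>This makes \<open>a\<close> a left multiple of \<open>b\<close>, so
      \<open>a\<close> inherits \<open>b * rp b = b\<close>.\<close>
    have "a * x * b = a" using xa axa by (simp add: mult.assoc)
    then show "a * rp b = a"
      using mult_is_rp [OF is_rp_rp, of b] by (metis mult.assoc)
    show "a = b * rp a" using rpa ax axa by (metis mult.assoc)
    show "a * a = a * b" using w xa by (metis mult.assoc)
  next
    assume a: "a = b * rp a" and aa: "a * a = a * b"
    show "x * a = x * b" using v aa by (metis mult.assoc)
    \<comment> \<open>Multiply \<open>a = b * x * a\<close> on the right by
      \<open>x\<close>.\<close>
    show "a * x = b * x" using a rpa xax by (metis mult.assoc)
  qed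
  then show ?thesis
    by (simp add: dual_core_le_def rstar_lsquare_le_def power2_eq_square x_def)
qed

end
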